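(* Consider an ISAC system with $K\ge0$ communication users whose sensing performance is measured by the radar SNR for detecting a target in a known direction $\theta_0$, $$\gamma_r(\mathbf{V})=\frac{\Upsilon\,\mathrm{tr}(\mathbf{A}^{H}(\theta_0)\mathbf{A}(\theta_0)\mathbf{V}\mathbf{V}^{H})}{\sigma^2}.$$ Then the minimum numbers of beamformers with and without cancellation of the interference from the sensing beams satisfy $$N_{\min}^{\mathrm{IC}}\le K+1,\qquad N_{\min}^{\mathrm{NIC}}\le\left\lfloor\sqrt{K^2+1}\right\rfloor=\begin{cases}1,&K=0,\\ K,&K>0.\end{cases}$$
   Context: Integers $N_T,N_R,\Upsilon\ge1$; reals $\sigma^2>0$, $P>0$; fixed channel vectors $\mathbf{h}_1,\dots,\mathbf{h}_K\in\mathbb{C}^{N_T}$; $\mathbf{A}(\theta_0)\in\mathbb{C}^{N_R\times N_T}$ is a fixed (nonzero) array-response matrix. Beamformers: for $N\ge K$, a beamforming matrix with $N$ beamformers is $\mathbf{V}=[\mathbf{v}_1,\dots,\mathbf{v}_K,\mathbf{V}_s]\in\mathbb{C}^{N_T\times N}$, with communication beamformers $\mathbf{v}_k\in\mathbb{C}^{N_T}$ and sensing beamformers $\mathbf{V}_s\in\mathbb{C}^{N_T\times(N-K)}$. SINRs with (IC) and without (NIC) interference cancellation: $\mathrm{SINR}^{\mathrm{IC}}_{k,\mathbf{V}}=\dfrac{|\mathbf{h}_k^{H}\mathbf{v}_k|^2}{\sum_{i\ne k}|\mathbf{h}_k^{H}\mathbf{v}_i|^2+\sigma^2}$, $\quad\mathrm{SINR}^{\mathrm{NIC}}_{k,\mathbf{V}}=\dfrac{|\mathbf{h}_k^{H}\mathbf{v}_k|^2}{\sum_{i\ne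 k}|\mathbf{h}_k^{H}\mathbf{v}_i|^2+\mathbf{h}_k^{H}\mathbf{V}_s\mathbf{V}_s^{H}\mathbf{h}_k+\sigma^2}$. Minimum number of beamformers: let $\gamma_k>0$ be given SINR targets. For $\bullet\in\{\mathrm{IC},\mathrm{NIC}\}$ and $N\ge K$ let $p_N^{*}$ be the optimal value of: maximize $\gamma_r(\mathbf{V})$ over $\mathbf{V}\in\mathbb{C}^{N_T\times N}$ subject to $\mathrm{SINR}^{\bullet}_{k,\mathbf{V}}\ge\gamma_k$ for all $k$ and $\mathrm{tr}(\mathbf{V}\mathbf{V}^{H})\le P$ (the constraints are assumed strictly feasible). $N_{\min}^{\bullet}$ is the smallest $N\ge K$ with $p_N^*=p_{N_T+K}^*$. *)

theory Defs
  imports "Jordan_Normal_Form.Schur_Decomposition" "HOL-Library.Extended_Real"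
begin

definition mat_trace :: "'a :: comm_monoid_add mat \<Rightarrow> 'a" where
  "mat_trace M = (\<Sum>i<dim_row M. M $$ (i, i))"

text \<open>
  Users are numbered \<open>0, \<dots>, K - 1\<close>. Column \<open>k < K\<close> of a beamforming matrix \<open>V\<close> with \<open>N \<ge> K\<close>
  columns is the communication beamformer of user \<open>k\<close>; the remaining \<open>N - K\<close> columns form \<open>V\<^sub>s\<close>.
  The product \<open>h\<^sup>H w\<close> is written \<open>w \<bullet>c h\<close>, as \<open>\<bullet>c\<close> conjugates its second argument.
\<close>

definition sensing_beamformers :: "nat \<Rightarrow> complex mat \<Rightarrow> complex mat" where
  "sensing_beamformers K V = mat (dim_row V) (dim_col V - K) (\<lambda>(i, j). V $$ (i, K + j))"

definition sinr_IC ::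
  "nat \<Rightarrow> (nat \<Rightarrow> complex vec) \<Rightarrow> real \<Rightarrow> complex mat \<Rightarrow> nat \<Rightarrow> real" where
  "sinr_IC K h \<sigma> V k =
     (cmod (col V k \<bullet>c h k))\<^sup>2 /
     ((\<Sum>i\<in>{..<K} - {k}. (cmod (col V i \<bullet>c h k))\<^sup>2) + \<sigma>\<^sup>2)"

text \<open>
  \<open>Re\<close> below only changes the type: \<open>h\<^sup>H V\<^sub>s V\<^sub>s\<^sup>H h\<close>, \<open>tr(A\<^sup>H A V V\<^sup>H)\<close> and \<open>tr(V V\<^sup>H)\<close> are real.
\<close>

definition sinr_NIC ::
  "nat \<Rightarrow> (nat \<Rightarrow> complex vec) \<Rightarrow> real \<Rightarrow> complex mat \<Rightarrow> nat \<Rightarrow> real" where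
  "sinr_NIC K h \<sigma> V k =
     (let Vs = sensing_beamformers K V in
     (cmod (col V k \<bullet>c h k))\<^sup>2 /
     ((\<Sum>i\<in>{..<K} - {k}. (cmod (col V i \<bullet>c h k))\<^sup>2)
       + Re (((Vs * mat_adjoint Vs) *\<^sub>v h k) \<bullet>c h k) + \<sigma>\<^sup>2))"

definition radar_snr :: "nat \<Rightarrow> real \<Rightarrow> complex mat \<Rightarrow> complex mat \<Rightarrow> real" where
  "radar_snr \<Upsilon> \<sigma> A V =
     real \<Upsilon> * Re (mat_trace (mat_adjoint A * A * V * mat_adjoint V)) / \<sigma>\<^sup>2"

definition transmit_power :: "complex mat \<Rightarrow> real" where
  "transmit_power V = Re (mat_trace (V * mat_adjoint V))"

definition feasible_beamformers ::
  "nat \<Rightarrow> nat \<Rightarrow> (complex mat \<Rightarrow> nat \<Rightarrow> real) \<Rightarrow> (nat \<Rightarrow> real) \<Rightarrow> real \<Rightarrow> nat \<Rightarrow> complex mat set" where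
  "feasible_beamformers N\<^sub>T K sinr \<gamma> P N =
     {V \<in> carrier_mat N\<^sub>T N. (\<forall>k<K. sinr V k \<ge> \<gamma> k) \<and> transmit_power V \<le> P}"

definition strictly_feasible ::
  "nat \<Rightarrow> nat \<Rightarrow> (complex mat \<Rightarrow> nat \<Rightarrow> real) \<Rightarrow> (nat \<Rightarrow> real) \<Rightarrow> real \<Rightarrow> nat \<Rightarrow> bool" where
  "strictly_feasible N\<^sub>T K sinr \<gamma> P N \<longleftrightarrow>
     (\<exists>V \<in> carrier_mat N\<^sub>T N. (\<forall>k<K. sinr V k > \<gamma> k) \<and> transmit_power V < P)"

definition optimal_value ::
  "nat \<Rightarrow> nat \<Rightarrow> (complex mat \<Rightarrow> nat \<Rightarrow> real) \<Rightarrow> (nat \<Rightarrow> real) \<Rightarrow> real \<Rightarrow> (complex mat \<Rightarrow> real)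
     \<Rightarrow> nat \<Rightarrow> ereal" where
  "optimal_value N\<^sub>T K sinr \<gamma> P obj N =
     (SUP V \<in> feasible_beamformers N\<^sub>T K sinr \<gamma> P N. ereal (obj V))"

text \<open>The \<open>LEAST\<close> below always exists, since \<open>N = N\<^sub>T + K\<close> qualifies.\<close>

definition N_min ::
  "nat \<Rightarrow> nat \<Rightarrow> (complex mat \<Rightarrow> nat \<Rightarrow> real) \<Rightarrow> (nat \<Rightarrow> real) \<Rightarrow> real \<Rightarrow> (complex mat \<Rightarrow> real) \<Rightarrow> nat" where
  "N_min N\<^sub>T K sinr \<gamma> P obj =
     (LEAST N. N \<ge> K \<and>
        optimal_value N\<^sub>T K sinr \<gamma> P obj N = optimal_value N\<^sub>T K sinr \<gamma> P obj (N\<^sub>T + K))"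

end

theory Submission
  imports Defs
begin

text \<open>
  It suffices to remove one beam from a feasible \<open>V\<close> without decreasing the radar SNR, as long as
  at least \<open>K + 1\<close> (IC) respectively \<open>K \<ge> 1\<close> (NIC) beams are left.
  With interference cancellation, sensing beams only consume power, so two of them can be replaced by
  the one with the better ratio of radar gain to power, rescaled.
  Without it, user \<open>0\<close> can absorb a sensing beam \<open>s\<close>: the covariance \<open>u\<^sub>0 u\<^sub>0\<^sup>H + s s\<^sup>H\<close> has rank at
  most \<open>2\<close>, and there is a direction that preserves all \<open>K\<close> SINR constraints and the power without
  decreasing the (linear) radar gain. Moving along it until a covariance becomes singular lowers the
  rank of user \<open>0\<close>'s covariance to one, since no other user's signal may vanish.
\<close>

section \<open>Linear systems and real quadratic forms\<close>

lemma underdetermined_system_nontrivial: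
  fixes c :: "nat \<Rightarrow> nat \<Rightarrow> 'a :: field"
  shows "\<exists>x. (\<exists>j<Suc m. x j \<noteq> 0) \<and> (\<forall>i<m. (\<Sum>j<Suc m. c i j * x j) = 0)"
proof -
  let ?M = "mat (Suc m) (Suc m) (\<lambda>(i, j). if i < m then c i j else 0)"
  have M: "?M \<in> carrier_mat (Suc m) (Suc m)" by simp
  \<comment> \<open>Row \<open>m\<close> is zero padding that makes the system square, so expanding
    along it gives determinant zero and hence a nonzero kernel vector.\<close>
  have "det ?M = (\<Sum>j<Suc m. ?M $$ (m, j) * cofactor ?M m j)"
    by (rule laplace_expansion_row[OF M]) simp
  also have "\<dots> = 0" by (intro sum.neutral) auto
  finally obtain v where v: "v \<in> carrier_vec (Suc m)" "v \<noteq> 0\<^sub>v (Suc m)"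
    "?M *\<^sub>v v = 0\<^sub>v (Suc m)"
    using det_0_iff_vec_prod_zero_field[OF M] by blast
  have "(\<Sum>j<Suc m. c i j * v $ j) = 0" if "i < m" for i
  proof -
    have "(\<Sum>j<Suc m. c i j * v $ j) = (?M *\<^sub>v v) $ i"
      using that v(1) by (auto simp: scalar_prod_def lessThan_atLeast0 intro!: sum.cong)
    then show ?thesis using v(3) that by simp
  qed
  moreover have "\<exists>j<Suc m. v $ j \<noteq> 0"
    using v(1,2) by (metis carrier_vecD eq_vecI index_zero_vec)
  ultimately show ?thesis by blast
qed

text \<open>Models a Hermitian form \<open>v^H Q v\<close> restricted to real combinations of two
  vectors; the polarised difference \<open>f (u + s) - f u - f s\<close> stands for the cross term
  \<open>2 Re (u^H Q s)\<close>. Received power, transmit power and radar gain can thus be handled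
  without naming their matrices.\<close>

definition real_quadratic :: "nat \<Rightarrow> (complex vec \<Rightarrow> real) \<Rightarrow> bool" where
  "real_quadratic n f \<longleftrightarrow> (\<forall>u\<in>carrier_vec n. \<forall>s\<in>carrier_vec n. \<forall>x y :: real.
     f (of_real x \<cdot>\<^sub>v u + of_real y \<cdot>\<^sub>v s) =
       x\<^sup>2 * f u + x * y * (f (u + s) - f u - f s) + y\<^sup>2 * f s)"

lemma real_quadraticD:
  assumes "real_quadratic n f" "u \<in> carrier_vec n" "s \<in> carrier_vec n"
  shows "f (of_real x \<cdot>\<^sub>v u + of_real y \<cdot>\<^sub>v s) =
       x\<^sup>2 * f u + x * y * (f (u + s) - f u - f s) + y\<^sup>2 * f s"
  using assms unfolding real_quadratic_def by blast

lemma real_quadratic_smult: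
  assumes "real_quadratic n f" "u \<in> carrier_vec n"
  shows "f (of_real x \<cdot>\<^sub>v u) = x\<^sup>2 * f u"
proof -
  have "of_real x \<cdot>\<^sub>v u + of_real 0 \<cdot>\<^sub>v u = of_real x \<cdot>\<^sub>v u"
    using assms(2) by (intro eq_vecI) auto
  then show ?thesis using real_quadraticD[OF assms assms(2), of x 0] by simp
qed

lemma real_quadratic_zero:
  assumes "real_quadratic n f"
  shows "f (0\<^sub>v n) = 0"
proof -
  have "of_real 0 \<cdot>\<^sub>v 0\<^sub>v n = (0\<^sub>v n :: complex vec)" by (intro eq_vecI) auto
  then show ?thesis using real_quadratic_smult[OF assms zero_carrier_vec, of 0] by simp
qed

lemma real_quadratic_sum:
  assumes "\<And>i. i \<in> I \<Longrightarrow> real_quadratic n (f i)"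
  shows "real_quadratic n (\<lambda>v. \<Sum>i\<in>I. f i v)"
  unfolding real_quadratic_def
proof (intro ballI allI)
  fix u s :: "complex vec" and x y :: real
  assume us: "u \<in> carrier_vec n" "s \<in> carrier_vec n"
  have "(\<Sum>i\<in>I. f i (of_real x \<cdot>\<^sub>v u + of_real y \<cdot>\<^sub>v s)) =
      (\<Sum>i\<in>I. x\<^sup>2 * f i u + x * y * (f i (u + s) - f i u - f i s) + y\<^sup>2 * f i s)"
    using real_quadraticD[OF assms us] by (intro sum.cong) auto
  then show "(\<Sum>i\<in>I. f i (of_real x \<cdot>\<^sub>v u + of_real y \<cdot>\<^sub>v s)) =
      x\<^sup>2 * (\<Sum>i\<in>I. f i u) + x * y * ((\<Sum>i\<in>I. f i (u + s)) - (\<Sum>i\<in>I. f i u) - (\<Sum>i\<in>I. f i s))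
      + y\<^sup>2 * (\<Sum>i\<in>I. f i s)"
    by (simp add: sum.distrib sum_subtractf sum_distrib_left right_diff_distrib)
qed

lemma real_quadratic_cmod_squared:
  fixes l :: "complex vec \<Rightarrow> complex"
  assumes add: "\<And>u s. u \<in> carrier_vec n \<Longrightarrow> s \<in> carrier_vec n \<Longrightarrow> l (u + s) = l u + l s"
    and smult: "\<And>u x. u \<in> carrier_vec n \<Longrightarrow> l (x \<cdot>\<^sub>v u) = x * l u"
  shows "real_quadratic n (\<lambda>v. (cmod (l v))\<^sup>2)"
proof -
  have "(cmod (of_real x * a + of_real y * b))\<^sup>2 =
      x\<^sup>2 * (cmod a)\<^sup>2 + x * y * ((cmod (a + b))\<^sup>2 - (cmod a)\<^sup>2 - (cmod b)\<^sup>2) + y\<^sup>2 * (cmod b)\<^sup>2"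
    for x y a b
    unfolding cmod_power2 by (simp add: power2_eq_square algebra_simps)
  then show ?thesis unfolding real_quadratic_def by (simp add: add smult)
qed

text \<open>
  The spectral theorem for the real symmetric matrix with diagonal \<open>a, d\<close> and off-diagonal entry
  \<open>b\<close>: the columns \<open>u, s\<close> are rotated into \<open>w, t\<close>, with eigenvalues \<open>\<alpha>, \<beta>\<close>.
\<close>

lemma diagonalise_pair:
  fixes a b d :: real
  assumes u: "u \<in> carrier_vec n" and s: "s \<in> carrier_vec n"
  obtains w t \<alpha> \<beta> where "w \<in> carrier_vec n" "t \<in> carrier_vec n"
    "\<And>f. real_quadratic n f \<Longrightarrow> f w + f t = f u + f s"
    "\<And>f. real_quadratic n f \<Longrightarrow>
       \<alpha> * f w + \<beta> * f t = a * f u + b * (f (u + s) - f u - f s) + d * f s"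
    "\<alpha> = 0 \<Longrightarrow> \<beta> = 0 \<Longrightarrow> a = 0 \<and> b = 0 \<and> d = 0"
proof -
  \<comment> \<open>\<open>z\<close> encodes the traceless part of the symmetric matrix: the
    eigenvalues are \<open>(a + d) / 2\<close> plus and minus its modulus, and half its argument is
    the rotation angle.\<close>
  define z where "z = Complex ((a - d) / 2) b"
  define r where "r = cmod z"
  define \<phi> where "\<phi> = Arg z / 2"
  have "z = rcis r (2 * \<phi>)" unfolding r_def \<phi>_def by (simp add: rcis_cmod_Arg)
  then have "Re z = r * cos (2 * \<phi>)" "Im z = r * sin (2 * \<phi>)" by simp_all
  then have a: "(a - d) / 2 = r * ((cos \<phi>)\<^sup>2 - (sin \<phi>)\<^sup>2)" and b: "b = r * (2 * sin \<phi> * cos \<phi>)"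
    unfolding z_def by (simp_all add: cos_double sin_double)
  define m where "m = (a + d) / 2"
  define C S where "C = cos \<phi>" and "S = sin \<phi>"
  have CS: "C\<^sup>2 + S\<^sup>2 = 1" unfolding C_def S_def by simp
  \<comment> \<open>Keeping the factor \<open>C\<^sup>2 + S\<^sup>2\<close> unevaluated turns the
    eigenvalue identity below into a polynomial identity in \<open>C\<close> and
    \<open>S\<close>.\<close>
  have a': "a = m * (C\<^sup>2 + S\<^sup>2) + r * (C\<^sup>2 - S\<^sup>2)" and d': "d = m * (C\<^sup>2 + S\<^sup>2) - r * (C\<^sup>2 - S\<^sup>2)"
    and b': "b = 2 * r * S * C"
    using a b by (simp_all add: CS) (simp_all add: m_def C_def S_def field_simps)
  let ?w = "of_real C \<cdot>\<^sub>v u + of_real S \<cdot>\<^sub>v s"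
  let ?t = "of_real (- S) \<cdot>\<^sub>v u + of_real C \<cdot>\<^sub>v s"
  show thesis
  proof (rule that[of ?w ?t "m + r" "m - r"])
    show "?w \<in> carrier_vec n" "?t \<in> carrier_vec n" using u s by auto
  next
    fix f assume f: "real_quadratic n f"
    note q = real_quadraticD[OF f u s]
    have "f ?w + f ?t = (C\<^sup>2 + S\<^sup>2) * f u + (C\<^sup>2 + S\<^sup>2) * f s"
      unfolding q by (simp add: algebra_simps)
    then show "f ?w + f ?t = f u + f s" by (simp add: CS)
    show "(m + r) * f ?w + (m - r) * f ?t = a * f u + b * (f (u + s) - f u - f s) + d * f s"
      unfolding q a' b' d' by (simp add: algebra_simps power2_eq_square)
  next
    assume "m + r = 0" "m - r = 0"
    then have "m = 0" "r = 0" by auto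
    then show "a = 0 \<and> b = 0 \<and> d = 0" by (simp add: a' b' d')
  qed
qed


section \<open>Exchanging beams under quadratic constraints\<close>

lemma sum_lessThan_first:
  fixes f :: "nat \<Rightarrow> real"
  assumes "0 < K"
  shows "(\<Sum>j<K. f j) = f 0 + (\<Sum>j=1..<K. f j)"
  using assms by (simp add: lessThan_atLeast0 sum.atLeast_Suc_lessThan)

text \<open>
  Perturbing the covariances \<open>u\<^sub>j u\<^sub>j\<^sup>H\<close> (\<open>0 < j < K\<close>) by scaling and the covariance
  \<open>u\<^sub>0 u\<^sub>0\<^sup>H + s s\<^sup>H\<close> by a real symmetric \<open>2 \<times> 2\<close> block gives \<open>K + 2\<close> real unknowns, one more than
  the number of constraints to be preserved.
\<close>

lemma constraint_preserving_direction:
  fixes u :: "nat \<Rightarrow> complex vec" and \<gamma> :: "nat \<Rightarrow> real"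
  assumes K: "0 < K"
    and u: "\<And>j. j < K \<Longrightarrow> u j \<in> carrier_vec n" and s: "s \<in> carrier_vec n"
    and q: "\<And>k. k < K \<Longrightarrow> real_quadratic n (q k)"
    and p: "real_quadratic n p" and g: "real_quadratic n g"
  obtains w t c \<beta> where "w \<in> carrier_vec n" "t \<in> carrier_vec n"
    "\<And>f. real_quadratic n f \<Longrightarrow> f w + f t = f (u 0) + f s"
    "\<And>k. 0 < k \<Longrightarrow> k < K \<Longrightarrow> (1 + \<gamma> k) * (c k * q k (u k)) =
       \<gamma> k * ((\<Sum>j<K. c j * q k ((u(0 := w)) j)) + \<beta> * q k t)"
    "(1 + \<gamma> 0) * (c 0 * q 0 w + \<beta> * q 0 t) =
       \<gamma> 0 * ((\<Sum>j<K. c j * q 0 ((u(0 := w)) j)) + \<beta> * q 0 t)"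
    "(\<Sum>j<K. c j * p ((u(0 := w)) j)) + \<beta> * p t = 0"
    "(\<Sum>j<K. c j * g ((u(0 := w)) j)) + \<beta> * g t \<ge> 0"
    "\<beta> \<noteq> 0 \<or> (\<exists>j<K. c j \<noteq> 0)"
proof -
  \<comment> \<open>Unknowns below \<open>K\<close> scale the users' covariances; unknown
    \<open>K\<close> is the weight of \<open>s\<close> and unknown \<open>Suc K\<close> the
    off-diagonal entry of user 0's block.\<close>
  define val where "val f j =
    (if j < K then f (u j) else if j = K then f s else f (u 0 + s) - f (u 0) - f s)"
    for f :: "complex vec \<Rightarrow> real" and j
  \<comment> \<open>Row \<open>K\<close> fixes the power, and row \<open>i < K\<close> keeps the
    slack of user \<open>i\<close>'s constraint. The whole block counts as the signal of user 0,
    whence the extra indices \<open>K\<close> and \<open>Suc K\<close> in row 0.\<close>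
  define eq where "eq i j =
    (if i = K then val p j
     else (1 + \<gamma> i) * (if j = i \<or> i = 0 \<and> K \<le> j then val (q i) j else 0) - \<gamma> i * val (q i) j)"
    for i j
  obtain x where x: "\<exists>j<Suc (Suc K). x j \<noteq> 0"
    and eqs: "\<And>i. i < Suc K \<Longrightarrow> (\<Sum>j<Suc (Suc K). eq i j * x j) = 0"
    using underdetermined_system_nontrivial[of "Suc K" eq] by blast
  have u0: "u 0 \<in> carrier_vec n" using u K by blast
  obtain w t \<alpha> \<beta> where w: "w \<in> carrier_vec n" and t: "t \<in> carrier_vec n"
    and tot: "\<And>f. real_quadratic n f \<Longrightarrow> f w + f t = f (u 0) + f s"
    and diag: "\<And>f. real_quadratic n f \<Longrightarrow> \<alpha> * f w + \<beta> * f t =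
       x 0 * f (u 0) + x (Suc K) * (f (u 0 + s) - f (u 0) - f s) + x K * f s"
    and nz: "\<alpha> = 0 \<Longrightarrow> \<beta> = 0 \<Longrightarrow> x 0 = 0 \<and> x (Suc K) = 0 \<and> x K = 0"
    using diagonalise_pair[OF u0 s, of "x 0" "x (Suc K)" "x K"] by blast
  \<comment> \<open>In the eigenbasis the block is described by the weight \<open>\<alpha>\<close>
    of \<open>w\<close>, which takes the place of the entry of user 0, and the weight
    \<open>\<beta>\<close> of \<open>t\<close>.\<close>
  define c where "c = x(0 := \<alpha>)"
  define T where "T f = (\<Sum>j<K. c j * f ((u(0 := w)) j)) + \<beta> * f t"
    for f :: "complex vec \<Rightarrow> real"
  have T: "T f = (\<Sum>j<Suc (Suc K). val f j * x j)" if f: "real_quadratic n f" for f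
  proof -
    have "(\<Sum>j<Suc (Suc K). val f j * x j) = (\<Sum>j<K. f (u j) * x j) + f s * x K
        + (f (u 0 + s) - f (u 0) - f s) * x (Suc K)"
      by (simp add: val_def)
    moreover have "(\<Sum>j=1..<K. c j * f ((u(0 := w)) j)) = (\<Sum>j=1..<K. f (u j) * x j)"
      by (intro sum.cong) (auto simp: c_def)
    ultimately show ?thesis
      unfolding T_def sum_lessThan_first[OF K] using diag[OF f]
      by (simp add: c_def algebra_simps)
  qed
  have E: "(\<Sum>j<Suc (Suc K). eq k j * x j) =
      (1 + \<gamma> k) * (\<Sum>j<Suc (Suc K). (if j = k \<or> k = 0 \<and> K \<le> j then val (q k) j else 0) * x j)
      - \<gamma> k * T (q k)" if "k < K" for k
    using that unfolding T[OF q[OF that]]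
    by (simp only: eq_def sum_distrib_left sum_subtractf[symmetric])
       (intro sum.cong, auto simp: algebra_simps)
  have k: "(1 + \<gamma> k) * (c k * q k (u k)) = \<gamma> k * T (q k)" if "0 < k" "k < K" for k
  proof -
    have "(\<Sum>j<Suc (Suc K). (if j = k \<or> k = 0 \<and> K \<le> j then val (q k) j else 0) * x j)
        = (\<Sum>j<Suc (Suc K). if j = k then val (q k) k * x k else 0)"
      using that by (intro sum.cong) auto
    also have "\<dots> = c k * q k (u k)"
      using that by (simp add: val_def c_def)
    finally show ?thesis using E[OF that(2)] eqs[of k] that by simp
  qed
  have z: "(1 + \<gamma> 0) * (c 0 * q 0 w + \<beta> * q 0 t) = \<gamma> 0 * T (q 0)"
  proof -
    have "(\<Sum>j<Suc (Suc K). (if j = 0 \<or> 0 = (0::nat) \<and> K \<le> j then val (q 0) j else 0) * x j)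
        = q 0 (u 0) * x 0 + q 0 s * x K + (q 0 (u 0 + s) - q 0 (u 0) - q 0 s) * x (Suc K)"
      using K by (simp add: val_def sum_lessThan_first[OF K])
    also have "\<dots> = c 0 * q 0 w + \<beta> * q 0 t"
      using K diag[OF q[OF K]] by (simp add: c_def algebra_simps)
    finally show ?thesis using E[OF K] eqs[of 0] by simp
  qed
  have pz: "T p = 0"
    using eqs[of K] unfolding T[OF p] by (simp add: eq_def)
  have cnz: "\<beta> \<noteq> 0 \<or> (\<exists>j<K. c j \<noteq> 0)"
  proof (rule ccontr)
    assume *: "\<not> (\<beta> \<noteq> 0 \<or> (\<exists>j<K. c j \<noteq> 0))"
    then have "\<alpha> = 0" "\<beta> = 0" using K by (auto simp: c_def)
    with nz have "x 0 = 0" "x (Suc K) = 0" "x K = 0" by auto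
    moreover have "x j = 0" if "0 < j" "j < K" for j using * that by (auto simp: c_def)
    ultimately show False using x by (metis less_Suc_eq neq0_conv)
  qed
  \<comment> \<open>The system is homogeneous, so the solution may be negated if the radar gain
    would decrease along it.\<close>
  show thesis
  proof (cases "T g \<ge> 0")
    case True
    show thesis
      by (rule that[of w t c \<beta>]) (use w t tot k z pz cnz True in \<open>auto simp: T_def\<close>)
  next
    case False
    have neg: "(\<Sum>j<K. - c j * f ((u(0 := w)) j)) + - \<beta> * f t = - T f" for f
      by (simp add: T_def sum_negf)
    show thesis
    proof (rule that[of w t "\<lambda>j. - c j" "- \<beta>"], unfold neg)
      fix k assume "0 < k" "k < K"
      then show "(1 + \<gamma> k) * (- c k * q k (u k)) = \<gamma> k * - T (q k)" using k[of k] by simp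
    next
      have "(1 + \<gamma> 0) * (- c 0 * q 0 w + - \<beta> * q 0 t) = - ((1 + \<gamma> 0) * (c 0 * q 0 w + \<beta> * q 0 t))"
        by (simp add: algebra_simps)
      then show "(1 + \<gamma> 0) * (- c 0 * q 0 w + - \<beta> * q 0 t) = \<gamma> 0 * - T (q 0)" using z by simp
    qed (use w t tot pz cnz False in auto)
  qed
qed

text \<open>
  The requirement \<open>SINR\<^sub>k \<ge> \<gamma>\<^sub>k\<close> appears here as \<open>\<gamma>\<^sub>k (total received power + noise) \<le>
  (1 + \<gamma>\<^sub>k) (signal power)\<close>, in which all beams enter the left-hand side alike.
\<close>

lemma absorb_beam:
  fixes u :: "nat \<Rightarrow> complex vec" and \<gamma> \<nu> :: "nat \<Rightarrow> real"
  assumes K: "0 < K"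
    and u: "\<And>j. j < K \<Longrightarrow> u j \<in> carrier_vec n" and s: "s \<in> carrier_vec n"
    and q: "\<And>k. k < K \<Longrightarrow> real_quadratic n (q k)"
    and p: "real_quadratic n p" and g: "real_quadratic n g"
    and q0: "\<And>k v. k < K \<Longrightarrow> q k v \<ge> 0" and p0: "\<And>v. p v \<ge> 0"
    and pdef: "\<And>v. v \<in> carrier_vec n \<Longrightarrow> p v = 0 \<Longrightarrow> v = 0\<^sub>v n"
    and \<gamma>: "\<And>k. k < K \<Longrightarrow> \<gamma> k > 0" and \<nu>: "\<And>k. k < K \<Longrightarrow> \<nu> k > 0"
    and feas: "\<And>k. k < K \<Longrightarrow>
      \<gamma> k * ((\<Sum>j<K. q k (u j)) + q k s + \<nu> k) \<le> (1 + \<gamma> k) * q k (u k)"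
  obtains u' where "\<And>j. j < K \<Longrightarrow> u' j \<in> carrier_vec n"
    "\<And>k. k < K \<Longrightarrow> \<gamma> k * ((\<Sum>j<K. q k (u' j)) + \<nu> k) \<le> (1 + \<gamma> k) * q k (u' k)"
    "(\<Sum>j<K. p (u' j)) = (\<Sum>j<K. p (u j)) + p s"
    "(\<Sum>j<K. g (u' j)) \<ge> (\<Sum>j<K. g (u j)) + g s"
proof -
  obtain w t c \<beta> where w: "w \<in> carrier_vec n" and t: "t \<in> carrier_vec n"
    and tot: "\<And>f. real_quadratic n f \<Longrightarrow> f w + f t = f (u 0) + f s"
    and ck: "\<And>k. 0 < k \<Longrightarrow> k < K \<Longrightarrow> (1 + \<gamma> k) * (c k * q k (u k)) =
       \<gamma> k * ((\<Sum>j<K. c j * q k ((u(0 := w)) j)) + \<beta> * q k t)"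
    and c0: "(1 + \<gamma> 0) * (c 0 * q 0 w + \<beta> * q 0 t) =
       \<gamma> 0 * ((\<Sum>j<K. c j * q 0 ((u(0 := w)) j)) + \<beta> * q 0 t)"
    and cp: "(\<Sum>j<K. c j * p ((u(0 := w)) j)) + \<beta> * p t = 0"
    and cg: "(\<Sum>j<K. c j * g ((u(0 := w)) j)) + \<beta> * g t \<ge> 0"
    and nz: "\<beta> \<noteq> 0 \<or> (\<exists>j<K. c j \<noteq> 0)"
    using constraint_preserving_direction[where u = u and q = q and \<gamma> = \<gamma>, OF K u s q p g]
    by blast
  define v where "v = u(0 := w)"
  have v0: "v 0 = w" and vk: "\<And>k. 0 < k \<Longrightarrow> v k = u k" by (auto simp: v_def)
  have v: "v j \<in> carrier_vec n" if "j < K" for j using that u w by (auto simp: v_def)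
  note ck = ck[folded v_def] and c0 = c0[folded v_def] and cp = cp[folded v_def]
    and cg = cg[folded v_def]
  define T where "T b b' f = (\<Sum>j<K. b j * f (v j)) + b' * f t"
    for b :: "nat \<Rightarrow> real" and b' :: real and f :: "complex vec \<Rightarrow> real"
  \<comment> \<open>Signal power under weights \<open>b\<close>, \<open>b'\<close>; user 0's signal
    temporarily occupies both \<open>w\<close> and \<open>t\<close>.\<close>
  define sig where "sig b b' k = b k * q k (v k) + (if k = 0 then b' * q 0 t else 0)"
    for b :: "nat \<Rightarrow> real" and b' :: real and k
  have T1: "T (\<lambda>_. 1) 1 f = (\<Sum>j<K. f (u j)) + f s" if "real_quadratic n f" for f
  proof -
    have "(\<Sum>j=1..<K. f (v j)) = (\<Sum>j=1..<K. f (u j))"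
      by (intro sum.cong) (auto simp: v_def)
    then show ?thesis
      using tot[OF that] by (simp add: T_def sum_lessThan_first[OF K] v0)
  qed
  \<comment> \<open>Counting \<open>s\<close> as signal of user 0 instead of interference can only
    help that user; the others see no change.\<close>
  have sig1: "sig (\<lambda>_. 1) 1 k \<ge> q k (u k)" if "k < K" for k
    using tot[OF q[OF K]] q0[OF K, of s] that by (auto simp: sig_def v0 vk)
  have feas1: "\<gamma> k * (T (\<lambda>_. 1) 1 (q k) + \<nu> k) \<le> (1 + \<gamma> k) * sig (\<lambda>_. 1) 1 k" if k: "k < K" for k
    using order_trans[OF feas[OF k] mult_left_mono[OF sig1[OF k]]] \<gamma>[OF k]
    unfolding T1[OF q[OF k]] by simp
  have sigc: "(1 + \<gamma> k) * sig c \<beta> k = \<gamma> k * T c \<beta> (q k)" if "k < K" for k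
    using c0 ck that v0 vk by (cases "k = 0") (auto simp: sig_def T_def)
  have Tlin: "T (\<lambda>j. 1 + r * c j) (1 + r * \<beta>) f = T (\<lambda>_. 1) 1 f + r * T c \<beta> f" for r f
    by (simp add: T_def algebra_simps sum.distrib sum_distrib_left)
  have siglin: "sig (\<lambda>j. 1 + r * c j) (1 + r * \<beta>) k = sig (\<lambda>_. 1) 1 k + r * sig c \<beta> k" for r k
    by (simp add: sig_def algebra_simps)
  note goal = that
  \<comment> \<open>Nonnegative weights become beams by scaling with their square roots. Since one
    of the weights of \<open>w\<close> and \<open>t\<close> vanishes, the other vector alone can
    serve as the beam of user 0.\<close>
  have finish: thesis
    if b: "\<And>j. j < K \<Longrightarrow> b j \<ge> 0" and b': "b' \<ge> 0" and sing: "b 0 = 0 \<or> b' = 0"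
      and bq: "\<And>k. k < K \<Longrightarrow> \<gamma> k * (T b b' (q k) + \<nu> k) \<le> (1 + \<gamma> k) * sig b b' k"
      and bp: "T b b' p = T (\<lambda>_. 1) 1 p" and bg: "T b b' g \<ge> T (\<lambda>_. 1) 1 g" for b b'
  proof -
    define u' where "u' j = (if j = 0 \<and> b 0 = 0 then of_real (sqrt b') \<cdot>\<^sub>v t
      else of_real (sqrt (b j)) \<cdot>\<^sub>v v j)" for j
    have u'k: "f (u' k) = b k * f (v k)" if "real_quadratic n f" "0 < k" "k < K" for f k
      using real_quadratic_smult[OF that(1) v[OF that(3)]] b that by (simp add: u'_def)
    have u'0: "f (u' 0) = b 0 * f w + b' * f t" if "real_quadratic n f" for f
      using real_quadratic_smult[OF that t] real_quadratic_smult[OF that w] b[OF K] b' sing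
      by (auto simp: u'_def v0)
    have u'T: "(\<Sum>j<K. f (u' j)) = T b b' f" if "real_quadratic n f" for f
    proof -
      have "(\<Sum>j=1..<K. f (u' j)) = (\<Sum>j=1..<K. b j * f (v j))"
        using u'k[OF that] by (intro sum.cong) auto
      then show ?thesis
        using u'0[OF that] by (simp add: T_def sum_lessThan_first[OF K] v0)
    qed
    have "sig b b' k = q k (u' k)" if "k < K" for k
      using that u'0[OF q] u'k[OF q] by (cases "k = 0") (auto simp: sig_def v0)
    moreover have "u' j \<in> carrier_vec n" if "j < K" for j
      using v[OF that] t by (simp add: u'_def)
    ultimately show thesis
      using bq bp bg by (intro goal[of u']) (simp_all add: u'T p g q T1)
  qed
  \<comment> \<open>The most negative coefficient limits the step: at \<open>r = - 1 / m\<close> all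
    weights are still nonnegative and one of them reaches zero.\<close>
  define m where "m = Min (insert \<beta> (c ` {..<K}))"
  have m: "m \<le> \<beta>" "\<And>j. j < K \<Longrightarrow> m \<le> c j" "m = \<beta> \<or> (\<exists>j<K. m = c j)"
    using Min_in[of "insert \<beta> (c ` {..<K})"] by (auto simp: m_def)
  show thesis
  proof (cases "m < 0")
    case True
    define r where "r = - 1 / m"
    have r: "r > 0" using True by (simp add: r_def)
    have ge: "1 + r * y \<ge> 0" if "m \<le> y" for y
    proof -
      have "r * m \<le> r * y" using that r by (intro mult_left_mono) auto
      then show ?thesis using True by (simp add: r_def)
    qed
    have m1: "1 + r * m = 0" using True by (simp add: r_def)
    define b where "b j = 1 + r * c j" for j
    define b' where "b' = 1 + r * \<beta>"
    have b: "\<And>j. j < K \<Longrightarrow> b j \<ge> 0" "b' \<ge> 0" using m ge by (auto simp: b_def b'_def)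
    have bT: "T b b' f = T (\<lambda>_. 1) 1 f + r * T c \<beta> f" for f
      using Tlin[of r f] unfolding b_def b'_def .
    have bsig: "sig b b' k = sig (\<lambda>_. 1) 1 k + r * sig c \<beta> k" for k
      using siglin[of r k] unfolding b_def b'_def .
    \<comment> \<open>The direction changes both sides of each constraint equally, so the slack at
      weights one is retained.\<close>
    have bq: "\<gamma> k * (T b b' (q k) + \<nu> k) \<le> (1 + \<gamma> k) * sig b b' k" if k: "k < K" for k
    proof -
      have "(1 + \<gamma> k) * (r * sig c \<beta> k) = \<gamma> k * (r * T c \<beta> (q k))"
        using sigc[OF k] by (metis mult.left_commute)
      then show ?thesis using feas1[OF k] unfolding bT bsig by (simp add: algebra_simps)
    qed
    \<comment> \<open>A user \<open>k > 0\<close> with weight zero would receive no signal, which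
      contradicts its constraint because \<gamma> and \<nu> are positive. The vanishing weight
      therefore belongs to \<open>w\<close> or \<open>t\<close>.\<close>
    have bpos: "b k \<noteq> 0" if k: "0 < k" "k < K" for k
    proof
      assume "b k = 0"
      then have "sig b b' k = 0" using k by (simp add: sig_def)
      moreover have "T b b' (q k) \<ge> 0"
        unfolding T_def using k q0 b by (intro add_nonneg_nonneg sum_nonneg mult_nonneg_nonneg) auto
      then have "\<gamma> k * (T b b' (q k) + \<nu> k) > 0"
        using \<gamma>[OF k(2)] \<nu>[OF k(2)] by (intro mult_pos_pos add_nonneg_pos)
      ultimately show False using bq[OF k(2)] by simp
    qed
    have "b' = 0 \<or> (\<exists>j<K. b j = 0)" using m(3) m1 by (auto simp: b_def b'_def)
    then have "b 0 = 0 \<or> b' = 0" using bpos by (metis neq0_conv)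
    moreover have "T c \<beta> p = 0" "T c \<beta> g \<ge> 0" using cp cg by (simp_all add: T_def)
    ultimately show thesis using finish[of b b'] b bq r by (simp add: bT)
  next
    case False
    have nonneg: "c j * p (v j) \<ge> 0" "\<beta> * p t \<ge> 0" if "j < K" for j
      using m False p0 that by (smt (verit) mult_nonneg_nonneg)+
    have "(\<Sum>j<K. c j * p (v j)) \<ge> 0" by (intro sum_nonneg nonneg(1)) simp
    then have \<beta>p: "\<beta> * p t = 0" and cps: "(\<Sum>j<K. c j * p (v j)) = 0"
      using cp nonneg(2)[OF K] by linarith+
    have cpj: "c j * p (v j) = 0" if "j < K" for j
      using cps that nonneg(1) sum_nonneg_eq_0_iff[of "{..<K}" "\<lambda>j. c j * p (v j)"] by auto
    have "c k = 0" if k: "0 < k" "k < K" for k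
    proof (rule ccontr)
      assume "c k \<noteq> 0"
      then have "p (u k) = 0" using cpj[OF k(2)] vk[OF k(1)] by simp
      then have "q k (u k) = 0"
        using pdef[OF u] real_quadratic_zero[OF q] k by metis
      moreover have "\<gamma> k * ((\<Sum>j<K. q k (u j)) + q k s + \<nu> k) > 0"
        using \<gamma> \<nu> q0 k by (intro mult_pos_pos add_nonneg_pos add_nonneg_nonneg sum_nonneg) auto
      ultimately show False using feas[OF k(2)] by simp
    qed
    then have "p w = 0 \<or> p t = 0" using nz cpj[OF K] \<beta>p v0 by (metis mult_eq_0_iff neq0_conv)
    then consider "w = 0\<^sub>v n" | "t = 0\<^sub>v n" using pdef w t by blast
    then show thesis
    proof cases
      case 1
      have eq: "T ((\<lambda>_. 1)(0 := 0)) 1 f = T (\<lambda>_. 1) 1 f" if "real_quadratic n f" for f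
      proof -
        have "(\<Sum>j=1..<K. ((\<lambda>_. 1)(0 := 0)) j * f (v j)) = (\<Sum>j=1..<K. f (v j))"
          by (intro sum.cong) auto
        then show ?thesis
          using real_quadratic_zero[OF that] 1 by (simp add: T_def sum_lessThan_first[OF K] v0)
      qed
      have "sig ((\<lambda>_. 1)(0 := 0)) 1 k = sig (\<lambda>_. 1) 1 k" if "k < K" for k
        using real_quadratic_zero[OF q[OF that]] 1 by (auto simp: sig_def v0)
      then show thesis
        using finish[of "(\<lambda>_. 1)(0 := 0)" 1] feas1 by (simp add: eq p g q)
    next
      case 2
      have eq: "T (\<lambda>_. 1) 0 f = T (\<lambda>_. 1) 1 f" if "real_quadratic n f" for f
        using real_quadratic_zero[OF that] 2 by (simp add: T_def)
      have "sig (\<lambda>_. 1) 0 k = sig (\<lambda>_. 1) 1 k" if "k < K" for k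
        using real_quadratic_zero[OF q[OF that]] 2 by (auto simp: sig_def)
      then show thesis
        using finish[of "\<lambda>_. 1" 0] feas1 by (simp add: eq p g q)
    qed
  qed
qed

lemma merge_beams:
  assumes s: "s \<in> carrier_vec n" and t: "t \<in> carrier_vec n"
    and p: "real_quadratic n p" and g: "real_quadratic n g"
    and p0: "\<And>v. p v \<ge> 0" and g0: "\<And>v. g v \<ge> 0"
    and pdef: "\<And>v. v \<in> carrier_vec n \<Longrightarrow> p v = 0 \<Longrightarrow> v = 0\<^sub>v n"
  obtains r where "r \<in> carrier_vec n" "p r = p s + p t" "g r \<ge> g s + g t"
proof -
  note goal = that
  \<comment> \<open>Here \<open>v\<close> has the better ratio of gain to power. The comparison is
    cross-multiplied, and \<open>x\<close> scales \<open>v\<close> up to the combined power.\<close>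
  have *: thesis if v: "v \<in> carrier_vec n" and v': "v' \<in> carrier_vec n" and pv: "p v > 0"
    and le: "g v' * p v \<le> g v * p v'" and eq: "p v + p v' = p s + p t" "g v + g v' = g s + g t"
  for v v'
  proof -
    define x where "x = sqrt ((p v + p v') / p v)"
    have x2: "x\<^sup>2 = (p v + p v') / p v" using pv p0[of v'] by (simp add: x_def)
    have "g v' \<le> g v * p v' / p v" using le pv by (simp add: field_simps)
    then have "g v + g v' \<le> x\<^sup>2 * g v" using pv unfolding x2 by (simp add: field_simps)
    moreover have "x\<^sup>2 * p v = p v + p v'" using pv unfolding x2 by simp
    ultimately show thesis
      using goal[of "of_real x \<cdot>\<^sub>v v"] v eq
      by (simp add: real_quadratic_smult[OF p v] real_quadratic_smult[OF g v])
  qed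
  \<comment> \<open>A beam without power is the zero vector and has no gain, so the other beam
    already serves as the merged one.\<close>
  consider "p s = 0" | "p t = 0" | "p s > 0" "p t > 0" using p0 by (metis less_eq_real_def)
  then show thesis
  proof cases
    case 1
    then show thesis using that[OF t] pdef[OF s] real_quadratic_zero[OF g] by auto
  next
    case 2
    then show thesis using that[OF s] pdef[OF t] real_quadratic_zero[OF g] by auto
  next
    case 3
    then show thesis using *[OF s t] *[OF t s] by (cases "g t * p s \<le> g s * p t") auto
  qed
qed


section \<open>Traces and SINR requirements as sums over columns\<close>

lemma mat_adjoint_index:
  fixes M :: "complex mat"
  assumes "i < dim_col M" "j < dim_row M"
  shows "mat_adjoint M $$ (i, j) = cnj (M $$ (j, i))"
  using assms by (simp add: mat_adjoint_def mat_of_rows_index conjugate_complex_def)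

lemma mat_adjoint_dim [simp]:
  fixes M :: "complex mat"
  shows "dim_row (mat_adjoint M) = dim_col M" "dim_col (mat_adjoint M) = dim_row M"
  by (simp_all add: mat_adjoint_def)

lemma mat_adjoint_carrier:
  fixes M :: "complex mat"
  assumes "M \<in> carrier_mat n m"
  shows "mat_adjoint M \<in> carrier_mat m n"
  using assms by auto

lemma mat_trace_mult_comm:
  fixes X Y :: "complex mat"
  assumes "X \<in> carrier_mat n m" "Y \<in> carrier_mat m n"
  shows "mat_trace (X * Y) = mat_trace (Y * X)"
proof -
  have "mat_trace (X * Y) = (\<Sum>i<n. \<Sum>j<m. X $$ (i, j) * Y $$ (j, i))"
    using assms by (simp add: mat_trace_def scalar_prod_def lessThan_atLeast0)
  also have "\<dots> = (\<Sum>j<m. \<Sum>i<n. X $$ (i, j) * Y $$ (j, i))" by (rule sum.swap)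
  also have "\<dots> = mat_trace (Y * X)"
    using assms by (simp add: mat_trace_def scalar_prod_def lessThan_atLeast0 mult.commute)
  finally show ?thesis .
qed

lemma mat_trace_mult_adjoint:
  assumes M: "M \<in> carrier_mat n m"
  shows "mat_trace (M * mat_adjoint M) = of_real (\<Sum>j<m. \<Sum>i<n. (cmod (col M j $ i))\<^sup>2)"
proof -
  have "mat_trace (M * mat_adjoint M) = (\<Sum>i<n. \<Sum>j<m. of_real ((cmod (col M j $ i))\<^sup>2))"
    unfolding mat_trace_def using M
    by (auto simp: scalar_prod_def lessThan_atLeast0 mat_adjoint_index complex_norm_square
        simp del: of_real_power intro!: sum.cong)
  also have "\<dots> = (\<Sum>j<m. \<Sum>i<n. of_real ((cmod (col M j $ i))\<^sup>2))" by (rule sum.swap)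
  finally show ?thesis by simp
qed

lemma transmit_power_columns:
  assumes "V \<in> carrier_mat n N"
  shows "transmit_power V = (\<Sum>j<N. \<Sum>i<n. (cmod (col V j $ i))\<^sup>2)"
  unfolding transmit_power_def mat_trace_mult_adjoint[OF assms] by simp

text \<open>Cyclicity of the trace turns \<open>tr(A^H A V V^H)\<close> into the squared Frobenius
  norm of \<open>A V\<close>, which splits into one contribution per beam.\<close>

lemma radar_snr_columns:
  assumes A: "A \<in> carrier_mat m n" and V: "V \<in> carrier_mat n N"
  shows "radar_snr \<Upsilon> \<sigma> A V =
    real \<Upsilon> * (\<Sum>j<N. \<Sum>i<m. (cmod ((A *\<^sub>v col V j) $ i))\<^sup>2) / \<sigma>\<^sup>2"
proof -
  note AH = mat_adjoint_carrier[OF A] and VH = mat_adjoint_carrier[OF V]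
  have AV: "A * V \<in> carrier_mat m N" using A V by simp
  have adj: "mat_adjoint (A * V) = mat_adjoint V * mat_adjoint A"
  proof (rule eq_matI)
    fix i j assume "i < dim_row (mat_adjoint V * mat_adjoint A)"
      "j < dim_col (mat_adjoint V * mat_adjoint A)"
    then have "i < N" "j < m" using A V by auto
    then show "mat_adjoint (A * V) $$ (i, j) = (mat_adjoint V * mat_adjoint A) $$ (i, j)"
      using A V
      by (auto simp: mat_adjoint_index scalar_prod_def mult.commute intro!: sum.cong)
  qed (use AH VH mat_adjoint_carrier[OF AV] in auto)
  have "mat_adjoint A * A * V * mat_adjoint V = mat_adjoint A * (A * V * mat_adjoint V)"
    using AH A V VH AV by (simp add: assoc_mult_mat[of _ n m _ n] assoc_mult_mat[of _ n m _ N _ n])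
  then have "mat_trace (mat_adjoint A * A * V * mat_adjoint V)
      = mat_trace (A * V * mat_adjoint V * mat_adjoint A)"
    using mat_trace_mult_comm[OF AH, of "A * V * mat_adjoint V"] AV VH by simp
  also have "A * V * mat_adjoint V * mat_adjoint A = A * V * mat_adjoint (A * V)"
    unfolding adj using AV VH AH by (simp add: assoc_mult_mat[of _ m N _ n _ m])
  finally have "mat_trace (mat_adjoint A * A * V * mat_adjoint V)
      = of_real (\<Sum>j<N. \<Sum>i<m. (cmod (col (A * V) j $ i))\<^sup>2)"
    unfolding mat_trace_mult_adjoint[OF AV] .
  moreover have "(\<Sum>j<N. \<Sum>i<m. (cmod (col (A * V) j $ i))\<^sup>2)
      = (\<Sum>j<N. \<Sum>i<m. (cmod ((A *\<^sub>v col V j) $ i))\<^sup>2)"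
    using A V by (intro sum.cong) auto
  ultimately show ?thesis by (simp add: radar_snr_def)
qed

text \<open>The form is the squared norm of \<open>M^H x\<close>, whose entries are the conjugates
  of the products of \<open>x\<close> with the columns.\<close>

lemma gram_form_columns:
  assumes M: "M \<in> carrier_mat n m" and x: "x \<in> carrier_vec n"
  shows "((M * mat_adjoint M) *\<^sub>v x) \<bullet>c x = of_real (\<Sum>j<m. (cmod (col M j \<bullet>c x))\<^sup>2)"
proof -
  note MH = mat_adjoint_carrier[OF M]
  define y where "y = mat_adjoint M *\<^sub>v x"
  have y: "y $ j = cnj (col M j \<bullet>c x)" if "j < m" for j
    using that M x unfolding y_def
    by (auto simp: scalar_prod_def mat_adjoint_index conjugate_complex_def intro!: sum.cong)
  have "((M * mat_adjoint M) *\<^sub>v x) \<bullet>c x = (M *\<^sub>v y) \<bullet>c x"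
    unfolding y_def using M MH x by (simp add: assoc_mult_mat_vec[of _ n m])
  also have "\<dots> = (\<Sum>i<n. \<Sum>j<m. M $$ (i, j) * y $ j * cnj (x $ i))"
    using M MH x
    by (auto simp: scalar_prod_def conjugate_complex_def sum_distrib_right lessThan_atLeast0
        y_def intro!: sum.cong)
  also have "\<dots> = (\<Sum>j<m. \<Sum>i<n. M $$ (i, j) * y $ j * cnj (x $ i))" by (rule sum.swap)
  also have "\<dots> = (\<Sum>j<m. (col M j \<bullet>c x) * y $ j)"
    using M x
    by (auto simp: scalar_prod_def conjugate_complex_def sum_distrib_left sum_distrib_right
        lessThan_atLeast0 mult_ac intro!: sum.cong)
  also have "\<dots> = (\<Sum>j<m. of_real ((cmod (col M j \<bullet>c x))\<^sup>2))"
    by (intro sum.cong) (auto simp: y complex_norm_square simp del: of_real_power)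
  finally show ?thesis by simp
qed

lemma sinr_IC_ge_iff:
  assumes "\<sigma>\<^sup>2 > 0"
  shows "c \<le> sinr_IC K h \<sigma> V k \<longleftrightarrow>
    c * ((\<Sum>i\<in>{..<K} - {k}. (cmod (col V i \<bullet>c h k))\<^sup>2) + \<sigma>\<^sup>2) \<le> (cmod (col V k \<bullet>c h k))\<^sup>2"
  unfolding sinr_IC_def using assms
  by (intro pos_le_divide_eq add_nonneg_pos sum_nonneg) auto

text \<open>Clear the positive denominator and add \<open>c\<close> times the signal to both sides:
  this completes the interference to a sum over all \<open>N\<close> beams.\<close>

lemma sinr_NIC_ge_iff:
  assumes V: "V \<in> carrier_mat n N" and h: "h k \<in> carrier_vec n" and k: "k < K" and K: "K \<le> N"
    and \<sigma>: "\<sigma>\<^sup>2 > 0"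
  shows "c \<le> sinr_NIC K h \<sigma> V k \<longleftrightarrow>
    c * ((\<Sum>j<N. (cmod (col V j \<bullet>c h k))\<^sup>2) + \<sigma>\<^sup>2) \<le> (1 + c) * (cmod (col V k \<bullet>c h k))\<^sup>2"
proof -
  let ?f = "\<lambda>j. (cmod (col V j \<bullet>c h k))\<^sup>2"
  let ?Vs = "sensing_beamformers K V"
  have Vs: "?Vs \<in> carrier_mat n (N - K)" using V by (auto simp: sensing_beamformers_def)
  have "col ?Vs j = col V (K + j)" if "j < N - K" for j
    using that V by (auto simp: sensing_beamformers_def)
  then have "Re (((?Vs * mat_adjoint ?Vs) *\<^sub>v h k) \<bullet>c h k) = (\<Sum>j<N - K. ?f (K + j))"
    unfolding gram_form_columns[OF Vs h] by simp
  also have "\<dots> = (\<Sum>j=K..<N. ?f j)"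
    using sum.shift_bounds_nat_ivl[of ?f 0 K "N - K"] K by (simp add: lessThan_atLeast0 add.commute)
  finally have s: "sinr_NIC K h \<sigma> V k =
      ?f k / ((\<Sum>i\<in>{..<K} - {k}. ?f i) + (\<Sum>j=K..<N. ?f j) + \<sigma>\<^sup>2)"
    by (simp add: sinr_NIC_def)
  have "(\<Sum>j<N. ?f j) = (\<Sum>j<K. ?f j) + (\<Sum>j=K..<N. ?f j)"
    using sum.atLeastLessThan_concat[of 0 K N ?f] K by (simp add: lessThan_atLeast0)
  also have "(\<Sum>j<K. ?f j) = ?f k + (\<Sum>i\<in>{..<K} - {k}. ?f i)"
    using k by (intro sum.remove) auto
  finally have tot: "(\<Sum>j<N. ?f j) = ?f k + (\<Sum>i\<in>{..<K} - {k}. ?f i) + (\<Sum>j=K..<N. ?f j)" .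
  have "(\<Sum>i\<in>{..<K} - {k}. ?f i) + (\<Sum>j=K..<N. ?f j) + \<sigma>\<^sup>2 > 0"
    using \<sigma> by (intro add_nonneg_pos add_nonneg_nonneg sum_nonneg) auto
  then show ?thesis unfolding s tot by (simp add: pos_le_divide_eq algebra_simps)
qed

lemma real_quadratic_user:
  "x \<in> carrier_vec n \<Longrightarrow> real_quadratic n (\<lambda>v. (cmod (v \<bullet>c x))\<^sup>2)"
  by (rule real_quadratic_cmod_squared) (auto simp: add_scalar_prod_distrib[of _ n])

lemma real_quadratic_power: "real_quadratic n (\<lambda>v. \<Sum>i<n. (cmod (v $ i))\<^sup>2)"
  by (intro real_quadratic_sum real_quadratic_cmod_squared) auto

lemma real_quadratic_radar:
  "A \<in> carrier_mat m n \<Longrightarrow> real_quadratic n (\<lambda>v. \<Sum>i<m. (cmod ((A *\<^sub>v v) $ i))\<^sup>2)"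
  by (intro real_quadratic_sum real_quadratic_cmod_squared)
     (auto simp: scalar_prod_add_distrib[of _ n])

lemma power_eq_0D:
  assumes "v \<in> carrier_vec n" "(\<Sum>i<n. (cmod (v $ i))\<^sup>2) = 0"
  shows "v = 0\<^sub>v n"
  using assms by (intro eq_vecI) (auto simp: sum_nonneg_eq_0_iff)

section \<open>From beam reductions to bounds on the minimum number of beams\<close>

lemma optimal_value_mono:
  assumes "\<And>V. V \<in> feasible_beamformers n K sinr \<gamma> P M \<Longrightarrow>
    \<exists>W \<in> feasible_beamformers n K sinr \<gamma> P N. obj V \<le> obj W"
  shows "optimal_value n K sinr \<gamma> P obj M \<le> optimal_value n K sinr \<gamma> P obj N"
  unfolding optimal_value_def using assms by (intro SUP_mono) auto

text \<open>Removing and adding beams one at a time makes the optimal value constant from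
  \<open>N\<close> on. Hence \<open>N\<close> attains the value at \<open>n + K\<close> and is a
  candidate for the minimum.\<close>

lemma N_min_le:
  assumes N: "K \<le> N" "N \<le> n + K"
    and reduce: "\<And>M V. N \<le> M \<Longrightarrow> V \<in> feasible_beamformers n K sinr \<gamma> P (Suc M) \<Longrightarrow>
      \<exists>W \<in> feasible_beamformers n K sinr \<gamma> P M. obj V \<le> obj W"
    and pad: "\<And>M V. K \<le> M \<Longrightarrow> V \<in> feasible_beamformers n K sinr \<gamma> P M \<Longrightarrow>
      \<exists>W \<in> feasible_beamformers n K sinr \<gamma> P (Suc M). obj V \<le> obj W"
  shows "N_min n K sinr \<gamma> P obj \<le> N"
proof -
  have "optimal_value n K sinr \<gamma> P obj M = optimal_value n K sinr \<gamma> P obj N" if "N \<le> M" for M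
    using that
  proof (induction M rule: dec_induct)
    case (step M)
    have "optimal_value n K sinr \<gamma> P obj (Suc M) = optimal_value n K sinr \<gamma> P obj M"
      using step.hyps N(1) by (intro antisym optimal_value_mono reduce pad) linarith+
    then show ?case using step.IH by (rule trans)
  qed (rule refl)
  from this[OF N(2)] show ?thesis unfolding N_min_def using N(1) by (intro Least_le) simp
qed

definition beams :: "nat \<Rightarrow> nat \<Rightarrow> (nat \<Rightarrow> complex vec) \<Rightarrow> complex mat" where
  "beams n N u = mat n N (\<lambda>(i, j). u j $ i)"

lemma beams_carrier [simp]: "beams n N u \<in> carrier_mat n N"
  by (simp add: beams_def)

lemma col_beams: "j < N \<Longrightarrow> u j \<in> carrier_vec n \<Longrightarrow> col (beams n N u) j = u j"
  by (intro eq_vecI) (auto simp: beams_def)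

context
  fixes n m \<Upsilon> K :: nat and \<sigma> P :: real and h :: "nat \<Rightarrow> complex vec" and \<gamma> :: "nat \<Rightarrow> real"
    and A :: "complex mat"
  assumes \<sigma>: "\<sigma>\<^sup>2 > 0" and h: "\<And>k. k < K \<Longrightarrow> h k \<in> carrier_vec n"
    and \<gamma>: "\<And>k. k < K \<Longrightarrow> \<gamma> k > 0" and A: "A \<in> carrier_mat m n"
begin

abbreviation "rx_power k v \<equiv> (cmod (v \<bullet>c h k))\<^sup>2"
abbreviation "beam_power v \<equiv> \<Sum>i<n. (cmod (v $ i))\<^sup>2"
abbreviation "radar_gain v \<equiv> \<Sum>i<m. (cmod ((A *\<^sub>v v) $ i))\<^sup>2"

lemma radar_snr_mono:
  assumes "V \<in> carrier_mat n N" "W \<in> carrier_mat n M"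
    and "(\<Sum>j<N. radar_gain (col V j)) \<le> (\<Sum>j<M. radar_gain (col W j))"
  shows "radar_snr \<Upsilon> \<sigma> A V \<le> radar_snr \<Upsilon> \<sigma> A W"
  unfolding radar_snr_columns[OF A assms(1)] radar_snr_columns[OF A assms(2)]
  using assms(3) \<sigma> by (intro divide_right_mono mult_left_mono) auto

lemma beam_power_nonneg: "beam_power v \<ge> 0" and radar_gain_nonneg: "radar_gain v \<ge> 0"
  by (simp_all add: sum_nonneg)

lemma radar_gain_zero: "radar_gain (0\<^sub>v n) = 0"
  by (rule real_quadratic_zero[OF real_quadratic_radar[OF A]])

text \<open>With cancellation the SINRs depend on the first \<open>K\<close> columns only, so
  leaving these untouched reduces feasibility to the power budget.\<close>

lemma improve_IC:
  assumes V: "V \<in> feasible_beamformers n K (sinr_IC K h \<sigma>) \<gamma> P N" and K: "K \<le> M"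
    and u: "\<And>j. j < M \<Longrightarrow> u j \<in> carrier_vec n" and com: "\<And>j. j < K \<Longrightarrow> u j = col V j"
    and p: "(\<Sum>j<M. beam_power (u j)) \<le> (\<Sum>j<N. beam_power (col V j))"
    and g: "(\<Sum>j<N. radar_gain (col V j)) \<le> (\<Sum>j<M. radar_gain (u j))"
  shows "\<exists>W \<in> feasible_beamformers n K (sinr_IC K h \<sigma>) \<gamma> P M. radar_snr \<Upsilon> \<sigma> A V \<le> radar_snr \<Upsilon> \<sigma> A W"
proof
  let ?W = "beams n M u"
  have col: "col ?W j = u j" if "j < M" for j using that u by (simp add: col_beams)
  have Vc: "V \<in> carrier_mat n N" using V by (simp add: feasible_beamformers_def)
  have "sinr_IC K h \<sigma> ?W k = sinr_IC K h \<sigma> V k" if "k < K" for k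
    using that K col com by (simp add: sinr_IC_def)
  then show "?W \<in> feasible_beamformers n K (sinr_IC K h \<sigma>) \<gamma> P M"
    using V p col
    by (auto simp: feasible_beamformers_def transmit_power_columns[OF Vc]
        transmit_power_columns[OF beams_carrier])
  show "radar_snr \<Upsilon> \<sigma> A V \<le> radar_snr \<Upsilon> \<sigma> A ?W"
    by (rule radar_snr_mono[OF Vc beams_carrier]) (use g col in simp)
qed

text \<open>Every column interferes here, so the new beams must meet the SINR requirements
  themselves, in total-power form.\<close>

lemma improve_NIC:
  assumes V: "V \<in> feasible_beamformers n K (sinr_NIC K h \<sigma>) \<gamma> P N" and K: "K \<le> M"
    and u: "\<And>j. j < M \<Longrightarrow> u j \<in> carrier_vec n"
    and q: "\<And>k. k < K \<Longrightarrow> \<gamma> k * ((\<Sum>j<M. rx_power k (u j)) + \<sigma>\<^sup>2) \<le> (1 + \<gamma> k) * rx_power k (u k)"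
    and p: "(\<Sum>j<M. beam_power (u j)) \<le> (\<Sum>j<N. beam_power (col V j))"
    and g: "(\<Sum>j<N. radar_gain (col V j)) \<le> (\<Sum>j<M. radar_gain (u j))"
  shows "\<exists>W \<in> feasible_beamformers n K (sinr_NIC K h \<sigma>) \<gamma> P M.
    radar_snr \<Upsilon> \<sigma> A V \<le> radar_snr \<Upsilon> \<sigma> A W"
proof
  let ?W = "beams n M u"
  have col: "col ?W j = u j" if "j < M" for j using that u by (simp add: col_beams)
  have Vc: "V \<in> carrier_mat n N" using V by (simp add: feasible_beamformers_def)
  have "\<gamma> k \<le> sinr_NIC K h \<sigma> ?W k" if "k < K" for k
    using q[OF that] that K
    by (simp add: sinr_NIC_ge_iff[where h = h, OF beams_carrier h that K \<sigma>] col)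
  then show "?W \<in> feasible_beamformers n K (sinr_NIC K h \<sigma>) \<gamma> P M"
    using V p col
    by (auto simp: feasible_beamformers_def transmit_power_columns[OF Vc]
        transmit_power_columns[OF beams_carrier])
  show "radar_snr \<Upsilon> \<sigma> A V \<le> radar_snr \<Upsilon> \<sigma> A ?W"
    by (rule radar_snr_mono[OF Vc beams_carrier]) (use g col in simp)
qed

lemma N_min_IC_le:
  assumes n: "n \<ge> 1"
  shows "N_min n K (sinr_IC K h \<sigma>) \<gamma> P (radar_snr \<Upsilon> \<sigma> A) \<le> K + 1"
proof (rule N_min_le)
  fix M V assume "K + 1 \<le> M" and V: "V \<in> feasible_beamformers n K (sinr_IC K h \<sigma>) \<gamma> P (Suc M)"
  \<comment> \<open>Of the \<open>Suc M\<close> columns at least two are sensing beams; the last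
    two, \<open>L\<close> and \<open>M\<close>, are merged.\<close>
  then obtain L where M: "M = Suc L" and L: "K \<le> L" by (cases M) auto
  have Vc: "V \<in> carrier_mat n (Suc M)" using V by (simp add: feasible_beamformers_def)
  have c: "col V j \<in> carrier_vec n" for j using Vc by (intro carrier_vecI) simp
  obtain r where r: "r \<in> carrier_vec n" "beam_power r = beam_power (col V L) + beam_power (col V M)"
    "radar_gain r \<ge> radar_gain (col V L) + radar_gain (col V M)"
    using merge_beams[OF c[of L] c[of M] real_quadratic_power real_quadratic_radar[OF A]
        beam_power_nonneg radar_gain_nonneg power_eq_0D] by blast
  show "\<exists>W \<in> feasible_beamformers n K (sinr_IC K h \<sigma>) \<gamma> P M.
      radar_snr \<Upsilon> \<sigma> A V \<le> radar_snr \<Upsilon> \<sigma> A W"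
    \<comment> \<open>The merged beam replaces column \<open>L\<close>, and column \<open>M\<close>
      is cut off because only \<open>M\<close> beams are kept.\<close>
    by (rule improve_IC[OF V, of _ "(col V)(L := r)"]) (use M L r c in auto)
next
  fix M V assume M: "K \<le> M" and V: "V \<in> feasible_beamformers n K (sinr_IC K h \<sigma>) \<gamma> P M"
  then have c: "col V j \<in> carrier_vec n" for j
    by (intro carrier_vecI) (auto simp: feasible_beamformers_def)
  show "\<exists>W \<in> feasible_beamformers n K (sinr_IC K h \<sigma>) \<gamma> P (Suc M).
      radar_snr \<Upsilon> \<sigma> A V \<le> radar_snr \<Upsilon> \<sigma> A W"
    \<comment> \<open>Column \<open>M\<close> lies outside \<open>V\<close>; overwriting it by zero
      pads \<open>V\<close> with a silent beam.\<close>
    by (rule improve_IC[OF V, of _ "(col V)(M := 0\<^sub>v n)"]) (use M c radar_gain_zero in auto)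
qed (use n in auto)

lemma N_min_NIC_le:
  assumes K: "K > 0"
  shows "N_min n K (sinr_NIC K h \<sigma>) \<gamma> P (radar_snr \<Upsilon> \<sigma> A) \<le> K"
proof (rule N_min_le)
  fix M V assume M: "K \<le> M" and V: "V \<in> feasible_beamformers n K (sinr_NIC K h \<sigma>) \<gamma> P (Suc M)"
  have Vc: "V \<in> carrier_mat n (Suc M)" using V by (simp add: feasible_beamformers_def)
  have c: "col V j \<in> carrier_vec n" for j using Vc by (intro carrier_vecI) simp
  have split: "(\<Sum>j<M. f j) = (\<Sum>j<K. f j) + (\<Sum>j=K..<M. f j)" for f :: "nat \<Rightarrow> real"
    using sum.atLeastLessThan_concat[of 0 K M f] M by (simp add: lessThan_atLeast0)
  \<comment> \<open>Sensing beams \<open>K\<close> to \<open>M - 1\<close> stay fixed, so their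
    interference joins the noise while the users absorb beam \<open>M\<close>.\<close>
  define \<nu> where "\<nu> k = (\<Sum>j=K..<M. rx_power k (col V j)) + \<sigma>\<^sup>2" for k
  have \<nu>: "\<nu> k > 0" for k
    unfolding \<nu>_def using \<sigma> by (intro add_nonneg_pos sum_nonneg) auto
  have feas: "\<gamma> k * ((\<Sum>j<K. rx_power k (col V j)) + rx_power k (col V M) + \<nu> k) \<le> (1 + \<gamma> k) * rx_power k (col V k)"
    if k: "k < K" for k
  proof -
    have "\<gamma> k \<le> sinr_NIC K h \<sigma> V k" using V k by (simp add: feasible_beamformers_def)
    then have "\<gamma> k * ((\<Sum>j<Suc M. rx_power k (col V j)) + \<sigma>\<^sup>2) \<le> (1 + \<gamma> k) * rx_power k (col V k)"
      using sinr_NIC_ge_iff[where h = h, OF Vc h[OF k] k le_SucI[OF M] \<sigma>] by simp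
    then show ?thesis by (simp add: split \<nu>_def algebra_simps)
  qed
  obtain u where u: "\<And>j. j < K \<Longrightarrow> u j \<in> carrier_vec n"
    and uq: "\<And>k. k < K \<Longrightarrow> \<gamma> k * ((\<Sum>j<K. rx_power k (u j)) + \<nu> k) \<le> (1 + \<gamma> k) * rx_power k (u k)"
    and up: "(\<Sum>j<K. beam_power (u j)) = (\<Sum>j<K. beam_power (col V j)) + beam_power (col V M)"
    and ug: "(\<Sum>j<K. radar_gain (u j)) \<ge> (\<Sum>j<K. radar_gain (col V j)) + radar_gain (col V M)"
    using absorb_beam[where u = "col V" and s = "col V M" and q = rx_power
        and p = beam_power and g = radar_gain
        and \<gamma> = \<gamma> and \<nu> = \<nu> and n = n, OF K c c real_quadratic_user[OF h] real_quadratic_power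
        real_quadratic_radar[OF A] zero_le_power2 beam_power_nonneg power_eq_0D \<gamma> \<nu> feas] by blast
  define u' where "u' j = (if j < K then u j else col V j)" for j
  have u': "(\<Sum>j<M. f (u' j)) = (\<Sum>j<K. f (u j)) + (\<Sum>j=K..<M. f (col V j))"
    for f :: "complex vec \<Rightarrow> real"
    unfolding split by (intro arg_cong2[of _ _ _ _ "(+)"] sum.cong) (auto simp: u'_def)
  show "\<exists>W \<in> feasible_beamformers n K (sinr_NIC K h \<sigma>) \<gamma> P M.
      radar_snr \<Upsilon> \<sigma> A V \<le> radar_snr \<Upsilon> \<sigma> A W"
  proof (rule improve_NIC[OF V M, of u'])
    show "u' j \<in> carrier_vec n" for j using u c by (simp add: u'_def)
    show "\<gamma> k * ((\<Sum>j<M. rx_power k (u' j)) + \<sigma>\<^sup>2) \<le> (1 + \<gamma> k) * rx_power k (u' k)" if "k < K" for k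
      using uq[OF that] that unfolding u'[of "rx_power k"] by (simp add: u'_def \<nu>_def add.assoc)
    show "(\<Sum>j<M. beam_power (u' j)) \<le> (\<Sum>j<Suc M. beam_power (col V j))"
      unfolding u'[of beam_power] up by (simp add: split)
    show "(\<Sum>j<Suc M. radar_gain (col V j)) \<le> (\<Sum>j<M. radar_gain (u' j))"
      unfolding u'[of radar_gain] using ug by (simp add: split)
  qed
next
  fix M V assume M: "K \<le> M" and V: "V \<in> feasible_beamformers n K (sinr_NIC K h \<sigma>) \<gamma> P M"
  then have Vc: "V \<in> carrier_mat n M" by (simp add: feasible_beamformers_def)
  then have c: "col V j \<in> carrier_vec n" for j by (intro carrier_vecI) simp
  show "\<exists>W \<in> feasible_beamformers n K (sinr_NIC K h \<sigma>) \<gamma> P (Suc M).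
      radar_snr \<Upsilon> \<sigma> A V \<le> radar_snr \<Upsilon> \<sigma> A W"
  proof (rule improve_NIC[OF V, of _ "(col V)(M := 0\<^sub>v n)"])
    fix k assume k: "k < K"
    have "\<gamma> k \<le> sinr_NIC K h \<sigma> V k" using V k by (simp add: feasible_beamformers_def)
    then have "\<gamma> k * ((\<Sum>j<M. rx_power k (col V j)) + \<sigma>\<^sup>2) \<le> (1 + \<gamma> k) * rx_power k (col V k)"
      using sinr_NIC_ge_iff[where h = h, OF Vc h[OF k] k M \<sigma>] by simp
    then show "\<gamma> k * ((\<Sum>j<Suc M. rx_power k (((col V)(M := 0\<^sub>v n)) j)) + \<sigma>\<^sup>2)
        \<le> (1 + \<gamma> k) * rx_power k (((col V)(M := 0\<^sub>v n)) k)"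
      using M k real_quadratic_zero[OF real_quadratic_user[OF h[OF k]]] by simp
  qed (use M c radar_gain_zero in auto)
qed auto

end

section \<open>Closed form of the bound and conclusion\<close>

lemma floor_sqrt_Suc_square: "\<lfloor>sqrt ((real K)\<^sup>2 + 1)\<rfloor> = (if K = 0 then 1 else int K)"
proof (cases "K = 0")
  case False
  have "sqrt ((real K)\<^sup>2 + 1) < real K + 1"
    using False by (intro real_less_lsqrt) (auto simp: power2_eq_square algebra_simps)
  moreover have "real K \<le> sqrt ((real K)\<^sup>2 + 1)" by (intro real_le_rsqrt) auto
  ultimately have "\<lfloor>sqrt ((real K)\<^sup>2 + 1)\<rfloor> = int K" by (intro floor_unique) auto
  then show ?thesis using False by simp
qed simp

theorem mainTheorem5:
  fixes N\<^sub>T N\<^sub>R \<Upsilon> K :: nat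
    and \<sigma> P :: real
    and h :: "nat \<Rightarrow> complex vec"
    and \<gamma> :: "nat \<Rightarrow> real"
    and A :: "real \<Rightarrow> complex mat"
    and \<theta>\<^sub>0 :: real
  assumes "N\<^sub>T \<ge> 1" and "N\<^sub>R \<ge> 1" and "\<Upsilon> \<ge> 1"
    and "\<sigma>\<^sup>2 > 0" and "P > 0"
    and "\<And>k. k < K \<Longrightarrow> h k \<in> carrier_vec N\<^sub>T"
    and "\<And>k. k < K \<Longrightarrow> \<gamma> k > 0"
    and "A \<theta>\<^sub>0 \<in> carrier_mat N\<^sub>R N\<^sub>T" and "A \<theta>\<^sub>0 \<noteq> 0\<^sub>m N\<^sub>R N\<^sub>T"
  shows "(strictly_feasible N\<^sub>T K (sinr_IC K h \<sigma>) \<gamma> P (N\<^sub>T + K) \<longrightarrow>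
            N_min N\<^sub>T K (sinr_IC K h \<sigma>) \<gamma> P (radar_snr \<Upsilon> \<sigma> (A \<theta>\<^sub>0)) \<le> K + 1) \<and>
         (strictly_feasible N\<^sub>T K (sinr_NIC K h \<sigma>) \<gamma> P (N\<^sub>T + K) \<longrightarrow>
            int (N_min N\<^sub>T K (sinr_NIC K h \<sigma>) \<gamma> P (radar_snr \<Upsilon> \<sigma> (A \<theta>\<^sub>0)))
              \<le> \<lfloor>sqrt ((real K)\<^sup>2 + 1)\<rfloor>) \<and>
         \<lfloor>sqrt ((real K)\<^sup>2 + 1)\<rfloor> = (if K = 0 then 1 else int K)"
proof -
  have IC: "N_min N\<^sub>T K (sinr_IC K h \<sigma>) \<gamma> P (radar_snr \<Upsilon> \<sigma> (A \<theta>\<^sub>0)) \<le> K + 1"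
    by (rule N_min_IC_le) (use assms in auto)
  have "int (N_min N\<^sub>T K (sinr_NIC K h \<sigma>) \<gamma> P (radar_snr \<Upsilon> \<sigma> (A \<theta>\<^sub>0)))
      \<le> \<lfloor>sqrt ((real K)\<^sup>2 + 1)\<rfloor>"
  proof (cases "K = 0")
    \<comment> \<open>Without users there are no SINR constraints, so the two problems coincide and
      the bound \<open>K + 1 = 1\<close> with cancellation applies.\<close>
    case True
    then have "N_min N\<^sub>T K (sinr_NIC K h \<sigma>) \<gamma> P (radar_snr \<Upsilon> \<sigma> (A \<theta>\<^sub>0)) =
        N_min N\<^sub>T K (sinr_IC K h \<sigma>) \<gamma> P (radar_snr \<Upsilon> \<sigma> (A \<theta>\<^sub>0))"
      by (simp add: N_min_def optimal_value_def feasible_beamformers_def)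
    then show ?thesis using IC True by simp
  next
    case False
    then have "N_min N\<^sub>T K (sinr_NIC K h \<sigma>) \<gamma> P (radar_snr \<Upsilon> \<sigma> (A \<theta>\<^sub>0)) \<le> K"
      by (intro N_min_NIC_le) (use assms in auto)
    then show ?thesis using False by (simp add: floor_sqrt_Suc_square)
  qed
  then show ?thesis using IC floor_sqrt_Suc_square by blast
qed

end
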